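(* For every real number $a\ge 3$ and every $n\in\mathbb{N}$ (positive integer), $$M_{\frac1a}(n)\le n\left(\frac23 a^2+\frac47\right)+2.$$
   Context: $\mathbb{S}^{n-1}$ denotes the unit sphere in $\mathbb{R}^n$. For $\alpha\in[0,1)$, an equiangular set in $\mathbb{S}^{n-1}$ with scalar products $\alpha,-\alpha$ is a finite set $X\subset\mathbb{S}^{n-1}$ such that the scalar product of any two distinct points of $X$ belongs to $\{\alpha,-\alpha\}$. $M_\alpha(n)$ denotes the maximum cardinality of an equiangular set in $\mathbb{S}^{n-1}$ with scalar products $\alpha,-\alpha$. *)

theory Defs
  imports "HOL-Analysis.Analysis"
begin

definition equiangular_set :: "real \<Rightarrow> (real ^ 'n) set \<Rightarrow> bool" where
  "equiangular_set \<alpha> X \<longleftrightarrow>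
     finite X \<and> X \<subseteq> sphere 0 1 \<and>
     (\<forall>x\<in>X. \<forall>y\<in>X. x \<noteq> y \<longrightarrow> x \<bullet> y \<in> {\<alpha>, - \<alpha>})"

text \<open>The type argument carries the dimension: \<^term>\<open>max_equiangular TYPE('n::finite) \<alpha>\<close>
  is the maximum over the unit sphere of \<^typ>\<open>real ^ 'n\<close>, so its dimension parameter is
  \<^term>\<open>CARD('n::finite)\<close>. For \<open>0 \<le> \<alpha> < 1\<close> the maximum is taken over a finite nonempty set of
  cardinalities (shown below), so it is attained.\<close>

definition max_equiangular :: "'n::finite itself \<Rightarrow> real \<Rightarrow> nat" where
  "max_equiangular _ \<alpha> = Max {card X | X :: (real ^ 'n) set. equiangular_set \<alpha> X}"

lemma equiangular_cards_nonempty: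
  "{card X | X :: (real ^ 'n) set. equiangular_set \<alpha> X} \<noteq> {}"
proof -
  have "equiangular_set \<alpha> ({} :: (real ^ 'n) set)"
    by (simp add: equiangular_set_def)
  then show ?thesis by blast
qed

lemma finite_equiangular_cards:
  assumes "0 \<le> \<alpha>" "\<alpha> < 1"
  shows "finite {card X | X :: (real ^ 'n) set. equiangular_set \<alpha> X}"
proof -
  define e where "e = sqrt (2 - 2 * \<alpha>) / 2"
  have e: "e > 0" using assms by (simp add: e_def)
  obtain K :: "(real ^ 'n) set" where K: "finite K" "sphere 0 1 \<subseteq> (\<Union>k\<in>K. ball k e)"
    using compact_sphere[of "0 :: real ^ 'n" 1] e unfolding compact_eq_totally_bounded by blast
  have "card X \<le> card K" if X: "equiangular_set \<alpha> X" for X :: "(real ^ 'n) set"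
  proof -
    have "\<forall>x\<in>X. \<exists>k\<in>K. dist k x < e"
      using X K(2) unfolding equiangular_set_def by fastforce
    then obtain f where f: "\<And>x. x \<in> X \<Longrightarrow> f x \<in> K \<and> dist (f x) x < e"
      by metis
    have "inj_on f X"
    proof (rule inj_onI, rule ccontr)
      fix x y assume xy: "x \<in> X" "y \<in> X" "f x = f y" "x \<noteq> y"
      have "dist x y \<le> dist (f x) x + dist (f y) y"
        using xy(3) dist_triangle3[of x y "f x"] by simp
      then have lt: "dist x y < sqrt (2 - 2 * \<alpha>)"
        using f[OF xy(1)] f[OF xy(2)] by (simp add: e_def)
      have n: "norm x = 1" "norm y = 1" and "x \<bullet> y \<in> {\<alpha>, - \<alpha>}"
        using X xy unfolding equiangular_set_def by auto
      then have "x \<bullet> y \<le> \<alpha>" using assms by auto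
      moreover have "(dist x y)\<^sup>2 = 2 - 2 * (x \<bullet> y)"
        using n by (simp add: dist_norm power2_norm_eq_inner inner_diff_left inner_diff_right
            inner_commute norm_eq_1)
      ultimately have "sqrt (2 - 2 * \<alpha>) \<le> dist x y"
        by (intro real_le_lsqrt) auto
      then show False using lt by simp
    qed
    then show ?thesis
      using card_inj_on_le[of f X K] f K(1) by blast
  qed
  then have "{card X | X :: (real ^ 'n) set. equiangular_set \<alpha> X} \<subseteq> {..card K}"
    by auto
  then show ?thesis by (rule finite_subset) simp
qed

end

theory Submission imports Defs begin

text \<open>Let \<open>u\<close> be a unit vector maximising \<open>\<Sum>x\<in>X. (x \<bullet> u)\<^sup>2\<close>, i.e. a top eigenvector of the
  frame operator \<open>F = \<Sum>x\<in>X. x x\<^sup>T\<close> with eigenvalue \<open>\<mu>\<close>. The matrices \<open>x x\<^sup>T\<close> have constant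
  pairwise Frobenius product \<open>\<alpha>\<^sup>2\<close>, so projecting the matrices \<open>x u\<^sup>T + u x\<^sup>T\<close> onto their
  span (as in Balla's matrix projection method) yields an upper bound for \<open>|X| D - \<mu>\<^sup>2\<close>, where
  \<open>D = 1 + \<alpha>\<^sup>2 (|X| - 1)\<close> and \<open>|X| D\<close> is the squared Frobenius norm of \<open>F\<close>. The Cauchy--Schwarz
  inequality for \<open>F - \<mu> u u\<^sup>T\<close> and \<open>I - u u\<^sup>T\<close> gives
  \<open>(|X| - \<mu>)\<^sup>2 \<le> (n - 1) (|X| D - \<mu>\<^sup>2)\<close>. Together with \<open>D \<le> \<mu> \<le> |X| / 2\<close>,
  valid once \<open>|X| \<ge> 7\<close>, these imply
  \<open>2 \<alpha>\<^sup>2 (|X| - 1) \<le> n - 1\<close>, which is stronger than the claim.\<close>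

text \<open>The rank-one matrix v w^T. The inner product of \<open>real ^ 'n ^ 'n\<close> is the
  Frobenius product, so pairing with \<open>mat 1\<close> is the trace.\<close>

definition outer :: "real ^ 'n \<Rightarrow> real ^ 'n \<Rightarrow> real ^ 'n ^ 'n" where
  "outer v w = (\<chi> i j. v $ i * w $ j)"

lemma inner_outer: "outer v w \<bullet> outer v' w' = (v \<bullet> v') * (w \<bullet> w')"
  by (simp add: outer_def inner_vec_def sum_product algebra_simps)

lemma inner_mat1_outer: "mat 1 \<bullet> outer v w = v \<bullet> w"
proof -
  have "(\<Sum>j\<in>UNIV. (if i = j then 1 else 0) * (v $ i * w $ j)) = v $ i * w $ i" for i
    by (simp add: if_distrib[of "\<lambda>c. c * _"] cong: if_cong)
  then show ?thesis
    by (simp add: outer_def inner_vec_def mat_def)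
qed

lemma inner_mat1_mat1: "(mat 1 :: real ^ 'n ^ 'n) \<bullet> mat 1 = real CARD('n)"
proof -
  have "(\<Sum>j\<in>UNIV. (if i = j then 1 else 0 :: real) * (if i = j then 1 else 0)) = 1"
    for i :: 'n
    by (simp add: if_distrib[of "\<lambda>c. c * _"] cong: if_cong)
  then show ?thesis
    by (simp add: inner_vec_def mat_def)
qed

text \<open>Serves for rows of Gram-type matrices: one formula covers every off-diagonal entry, and
  extending it over the diagonal costs a single correction term.\<close>

lemma sum_equal_off_diagonal:
  fixes f :: "'b \<Rightarrow> real"
  assumes "finite X" "x \<in> X" "f x = p" "\<And>y. y \<in> X \<Longrightarrow> y \<noteq> x \<Longrightarrow> f y = q y"
  shows "sum f X = p + sum q X - q x"
proof -
  have "sum f X = f x + sum f (X - {x})" "sum q X = q x + sum q (X - {x})"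
    using assms by (simp_all add: sum.remove)
  moreover have "sum f (X - {x}) = sum q (X - {x})"
    using assms by (intro sum.cong) auto
  ultimately show ?thesis using assms by simp
qed

text \<open>Bessel's inequality for the span of vectors with constant pairwise products \<open>s\<close>; the
  coefficients \<open>t\<close> are those of the orthogonal projection of \<open>W\<close>, scaled by \<open>1 - s\<close>.\<close>

lemma bessel_constant_inner:
  fixes f :: "'b \<Rightarrow> 'a::real_inner"
  assumes fin: "finite X" and s: "0 \<le> s" "s < 1"
    and unit: "\<And>x. x \<in> X \<Longrightarrow> f x \<bullet> f x = 1"
    and off: "\<And>x y. x \<in> X \<Longrightarrow> y \<in> X \<Longrightarrow> x \<noteq> y \<Longrightarrow> f x \<bullet> f y = s"
  defines "D \<equiv> 1 - s + s * real (card X)"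
  shows "(\<Sum>x\<in>X. (W \<bullet> f x)\<^sup>2) - s / D * (\<Sum>x\<in>X. W \<bullet> f x)\<^sup>2 \<le> (1 - s) * (W \<bullet> W)"
proof -
  define N where "N = real (card X)"
  define c where "c = s / D"
  define S where "S = (\<Sum>x\<in>X. W \<bullet> f x)"
  define Q where "Q = (\<Sum>x\<in>X. (W \<bullet> f x)\<^sup>2)"
  define t where "t = (\<lambda>x. W \<bullet> f x - c * S)"
  define V where "V = (\<Sum>x\<in>X. t x *\<^sub>R f x)"
  have D: "D > 0" using s by (simp add: D_def add_pos_nonneg)
  have cD: "c * D = s" using D by (simp add: c_def)
  \<comment> \<open>The Gram matrix of the \<open>f x\<close> is (1 - s) I + s J with J the all-ones
    matrix; this is its action on \<open>t\<close>.\<close>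
  have row: "(\<Sum>y\<in>X. t y * (f x \<bullet> f y)) = t x + s * (\<Sum>y\<in>X. t y) - s * t x" if "x \<in> X" for x
    using sum_equal_off_diagonal[OF fin that, of "\<lambda>y. t y * (f x \<bullet> f y)" "t x" "\<lambda>y. s * t y"]
      unit off that by (simp add: sum_distrib_left)
  have "V \<bullet> V = (\<Sum>x\<in>X. t x * (\<Sum>y\<in>X. t y * (f x \<bullet> f y)))"
    unfolding V_def inner_sum_left inner_sum_right sum_distrib_left
    by (intro sum.cong refl) (simp add: inner_commute)
  also have "\<dots> = (\<Sum>x\<in>X. t x * (t x + s * (\<Sum>y\<in>X. t y) - s * t x))"
    by (intro sum.cong) (simp_all add: row)
  also have "\<dots> = (\<Sum>x\<in>X. (1 - s) * (t x)\<^sup>2 + s * (\<Sum>y\<in>X. t y) * t x)"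
    by (intro sum.cong) (simp_all add: algebra_simps power2_eq_square)
  also have "\<dots> = (1 - s) * (\<Sum>x\<in>X. (t x)\<^sup>2) + s * (\<Sum>x\<in>X. t x)\<^sup>2"
    by (simp only: sum.distrib sum_distrib_left[symmetric] power2_eq_square mult.assoc)
  finally have VV: "V \<bullet> V = (1 - s) * (\<Sum>x\<in>X. (t x)\<^sup>2) + s * (\<Sum>x\<in>X. t x)\<^sup>2" .
  have t1: "(\<Sum>x\<in>X. t x) = S - c * S * N"
    by (simp add: t_def sum_subtractf S_def N_def)
  have "(\<Sum>x\<in>X. (t x)\<^sup>2) = (\<Sum>x\<in>X. (W \<bullet> f x)\<^sup>2 - 2 * c * S * (W \<bullet> f x) + c\<^sup>2 * S\<^sup>2)"
    by (intro sum.cong) (simp_all add: t_def power2_eq_square algebra_simps)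
  then have t2: "(\<Sum>x\<in>X. (t x)\<^sup>2) = Q - 2 * c * S * S + c\<^sup>2 * S\<^sup>2 * N"
    by (simp add: sum.distrib sum_subtractf Q_def N_def S_def sum_distrib_left[symmetric])
  have "W \<bullet> V = (\<Sum>x\<in>X. (W \<bullet> f x)\<^sup>2 - c * S * (W \<bullet> f x))"
    unfolding V_def inner_sum_right
    by (intro sum.cong) (simp_all add: t_def power2_eq_square algebra_simps)
  then have WV: "W \<bullet> V = Q - c * S * S"
    by (simp add: sum_subtractf Q_def S_def sum_distrib_left[symmetric])
  have "0 \<le> ((1 - s) *\<^sub>R W - V) \<bullet> ((1 - s) *\<^sub>R W - V)" by simp
  also have "\<dots> = (1 - s)\<^sup>2 * (W \<bullet> W) - 2 * (1 - s) * (W \<bullet> V) + V \<bullet> V"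
    by (simp add: inner_diff_left inner_diff_right inner_commute power2_eq_square algebra_simps)
  also have "\<dots> = (1 - s) * ((1 - s) * (W \<bullet> W) - Q)
      + S\<^sup>2 * ((1 - s) * c\<^sup>2 * N + s * (1 - c * N)\<^sup>2)"
    unfolding VV t1 t2 WV by (simp add: power2_eq_square algebra_simps)
  \<comment> \<open>The relation \<open>c * D = s\<close> says
    \<open>s * (1 - c * N) = (1 - s) * c\<close>, which collapses the coefficient of
    \<open>S\<^sup>2\<close> and leaves a common factor \<open>1 - s\<close>.\<close>
  also have "(1 - s) * c\<^sup>2 * N + s * (1 - c * N)\<^sup>2 = (1 - s) * c"
  proof -
    have "s * (1 - c * N) = (1 - s) * c"
      using cD by (simp add: D_def N_def algebra_simps)
    then have "s * (1 - c * N)\<^sup>2 = (1 - s) * c * (1 - c * N)"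
      by (simp add: power2_eq_square mult.assoc[symmetric])
    then show ?thesis
      by (simp add: power2_eq_square algebra_simps)
  qed
  finally have "0 \<le> (1 - s) * ((1 - s) * (W \<bullet> W) - Q + c * S\<^sup>2)"
    by (simp add: algebra_simps)
  then have "0 \<le> (1 - s) * (W \<bullet> W) - Q + c * S\<^sup>2"
    using s by (simp add: zero_le_mult_iff)
  then show ?thesis by (simp add: Q_def S_def c_def)
qed

text \<open>Compactness gives a maximiser on the sphere, homogeneity extends the bound to all
  vectors, and the first-order condition at the maximiser is the eigenvector equation.\<close>

lemma top_frame_eigenvector:
  fixes X :: "(real ^ 'n) set"
  assumes fin: "finite X"
  obtains u \<mu> where "norm u = 1"
    and "\<And>v. (\<Sum>x\<in>X. (x \<bullet> v)\<^sup>2) \<le> \<mu> * (v \<bullet> v)"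
    and "\<And>v. (\<Sum>x\<in>X. (x \<bullet> u) * (x \<bullet> v)) = \<mu> * (u \<bullet> v)"
proof -
  define q where "q = (\<lambda>v::real^'n. \<Sum>x\<in>X. (x \<bullet> v)\<^sup>2)"
  have "sphere (0::real^'n) 1 \<noteq> {}" by simp
  moreover have "continuous_on (sphere 0 1) q"
    unfolding q_def by (intro continuous_intros)
  ultimately obtain u where u: "norm u = 1" "\<And>v. norm v = 1 \<Longrightarrow> q v \<le> q u"
    using continuous_attains_sup[OF compact_sphere] by (metis mem_sphere_0)
  have max: "q v \<le> q u * (v \<bullet> v)" for v
  proof (cases "v = 0")
    case True then show ?thesis by (simp add: q_def)
  next
    case False
    define w where "w = v /\<^sub>R norm v"
    have v: "v = norm v *\<^sub>R w" using False by (simp add: w_def)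
    have "q v = (norm v)\<^sup>2 * q w"
      by (subst v) (simp add: q_def power_mult_distrib sum_distrib_left)
    also have "\<dots> \<le> (norm v)\<^sup>2 * q u"
      using False by (intro mult_left_mono u) (simp_all add: w_def)
    finally show ?thesis by (simp add: power2_norm_eq_inner mult.commute)
  qed
  have "(\<Sum>x\<in>X. (x \<bullet> u) * (x \<bullet> v)) = q u * (u \<bullet> v)" for v
  proof -
    \<comment> \<open>The nonnegative quadratic form \<open>q u * (v \<bullet> v) - q v\<close>
      vanishes at \<open>u\<close>. Its value at \<open>u + r *\<^sub>R v\<close> is
      \<open>2 * r * b + r\<^sup>2 * d\<close>, which forces \<open>b = 0\<close>.\<close>
    define b where "b = q u * (u \<bullet> v) - (\<Sum>x\<in>X. (x \<bullet> u) * (x \<bullet> v))"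
    define d where "d = q u * (v \<bullet> v) - q v"
    have d: "d \<ge> 0" using max[of v] by (simp add: d_def)
    have quad: "0 \<le> 2 * r * b + r\<^sup>2 * d" for r
    proof -
      have "q (u + r *\<^sub>R v) = (\<Sum>x\<in>X. (x \<bullet> u)\<^sup>2 + 2 * r * ((x \<bullet> u) * (x \<bullet> v)) + r\<^sup>2 * (x \<bullet> v)\<^sup>2)"
        unfolding q_def
        by (intro sum.cong) (simp_all add: inner_add_right power2_eq_square algebra_simps)
      also have "\<dots> = q u + 2 * r * (\<Sum>x\<in>X. (x \<bullet> u) * (x \<bullet> v)) + r\<^sup>2 * q v"
        by (simp add: q_def sum.distrib sum_distrib_left)
      finally have "q (u + r *\<^sub>R v) = q u + 2 * r * (\<Sum>x\<in>X. (x \<bullet> u) * (x \<bullet> v)) + r\<^sup>2 * q v" .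
      moreover have "(u + r *\<^sub>R v) \<bullet> (u + r *\<^sub>R v) = 1 + 2 * r * (u \<bullet> v) + r\<^sup>2 * (v \<bullet> v)"
        using u(1) by (simp add: inner_add_left inner_add_right norm_eq_1 inner_commute
            power2_eq_square algebra_simps)
      ultimately show ?thesis
        using max[of "u + r *\<^sub>R v"] by (simp add: b_def d_def algebra_simps)
    qed
    \<comment> \<open>The minimiser would be -b / d; the added 1 keeps the denominator positive when
      \<open>d = 0\<close>.\<close>
    define r where "r = - b / (d + 1)"
    have b: "b = - r * (d + 1)" using d by (simp add: r_def)
    have "0 \<le> - (r\<^sup>2 * (d + 2))"
      using quad[of r] unfolding b by (simp add: power2_eq_square algebra_simps)
    then have "r = 0" using d by (simp add: mult_le_0_iff)
    then have "b = 0" by (simp add: b)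
    then show ?thesis by (simp add: b_def)
  qed
  with u(1) max show ?thesis
    unfolding q_def by (intro that) auto
qed

lemma equiangular_card_bound:
  fixes X :: "(real ^ 'n) set"
  assumes X: "equiangular_set \<alpha> X" and \<alpha>: "\<alpha> \<noteq> 0" "\<alpha>\<^sup>2 \<le> 1 / 9" and card: "card X \<ge> 7"
  shows "2 * \<alpha>\<^sup>2 * (real (card X) - 1) \<le> real CARD('n) - 1"
proof -
  define s where "s = \<alpha>\<^sup>2"
  define N where "N = real (card X)"
  define n where "n = real CARD('n)"
  define D where "D = 1 - s + s * N"
  define F where "F = (\<Sum>x\<in>X. outer x x)"
  have s: "0 < s" "s \<le> 1 / 9" using \<alpha> by (simp_all add: s_def)
  have N: "N \<ge> 7" using card by (simp add: N_def)
  have n: "n \<ge> 1" by (simp add: n_def Suc_le_eq)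
  have D: "D > 0" using s N by (simp add: D_def add_pos_nonneg)
  have fin: "finite X" using X by (simp add: equiangular_set_def)
  have unit: "x \<bullet> x = 1" if "x \<in> X" for x
    using X that by (auto simp: equiangular_set_def norm_eq_1)
  have off: "(x \<bullet> y)\<^sup>2 = s" if "x \<in> X" "y \<in> X" "x \<noteq> y" for x y
  proof -
    have "x \<bullet> y = \<alpha> \<or> x \<bullet> y = - \<alpha>"
      using X that by (simp add: equiangular_set_def)
    then show ?thesis by (auto simp: s_def)
  qed
  have row: "(\<Sum>y\<in>X. (x \<bullet> y)\<^sup>2) = D" if "x \<in> X" for x
    using sum_equal_off_diagonal[OF fin that, of "\<lambda>y. (x \<bullet> y)\<^sup>2" 1 "\<lambda>_. s"] unit off that
    by (simp add: D_def N_def)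
  obtain u \<mu> where u: "norm u = 1" and max: "\<And>v. (\<Sum>x\<in>X. (x \<bullet> v)\<^sup>2) \<le> \<mu> * (v \<bullet> v)"
    and eig: "\<And>v. (\<Sum>x\<in>X. (x \<bullet> u) * (x \<bullet> v)) = \<mu> * (u \<bullet> v)"
    using top_frame_eigenvector[OF fin] by blast
  have uu: "u \<bullet> u = 1" using u by (simp add: norm_eq_1)
  have q: "(\<Sum>x\<in>X. (x \<bullet> u)\<^sup>2) = \<mu>" using eig[of u] uu by (simp add: power2_eq_square)
  \<comment> \<open>Any point of \<open>X\<close> is a unit trial vector on which the frame form
    takes the value \<open>D\<close>.\<close>
  obtain x0 where "x0 \<in> X" using card by (metis card.empty ex_in_conv not_numeral_le_zero)
  then have \<mu>D: "D \<le> \<mu>" using max[of x0] row[of x0] unit[of x0] by (simp add: inner_commute)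
  then have \<mu>: "\<mu> > 0" using D by simp

  have F_outer: "F \<bullet> outer v v = (\<Sum>x\<in>X. (x \<bullet> v)\<^sup>2)" for v
    by (simp add: F_def inner_sum_left inner_outer power2_eq_square)
  have Fu: "F \<bullet> outer u u = \<mu>" by (simp add: F_outer q)
  have "F \<bullet> F = (\<Sum>y\<in>X. F \<bullet> outer y y)"
    by (subst (2) F_def) (simp add: inner_sum_right)
  also have "\<dots> = (\<Sum>y\<in>X. D)"
    unfolding F_outer by (intro sum.cong refl) (simp add: row[symmetric] inner_commute)
  finally have FF: "F \<bullet> F = N * D" by (simp add: N_def)
  have IF: "mat 1 \<bullet> F = N"
    using unit by (simp add: F_def inner_sum_right inner_mat1_outer N_def)

  have \<mu>2: "\<mu>\<^sup>2 \<le> N * D"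
    using Cauchy_Schwarz_ineq[of F "outer u u"] by (simp add: Fu FF inner_outer uu)
  \<comment> \<open>With s \<le> 1/9, D \<le> N/4 follows from 8/9 + N/9 \<le> N/4, that is N \<ge>
    6.4; hence the threshold 7.\<close>
  have "N * D \<le> (N / 2)\<^sup>2"
  proof -
    have "s * (N - 1) \<le> 1 / 9 * (N - 1)"
      using s N by (intro mult_right_mono) auto
    then have "D \<le> N / 4" using N by (simp add: D_def algebra_simps)
    then have "N * D \<le> N * (N / 4)" using N by (intro mult_left_mono) auto
    then show ?thesis by (simp add: power2_eq_square)
  qed
  with \<mu>2 have "\<mu>\<^sup>2 \<le> (N / 2)\<^sup>2" by simp
  then have \<mu>N: "\<mu> \<le> N / 2" using N by (intro power2_le_imp_le[of \<mu> "N / 2"]) auto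

  have trace: "(N - \<mu>)\<^sup>2 \<le> (n - 1) * (N * D - \<mu>\<^sup>2)"
  proof -
    \<comment> \<open>\<open>A\<close> is the frame operator without its top eigenvalue and
      \<open>B\<close> projects onto the complement of \<open>u\<close>, so their product is the sum
      of the remaining eigenvalues.\<close>
    define A where "A = F - \<mu> *\<^sub>R outer u u"
    define B where "B = mat 1 - outer u u"
    have "A \<bullet> A = N * D - \<mu>\<^sup>2"
      by (simp add: A_def inner_diff_left inner_diff_right inner_commute[of "outer u u" F]
          Fu FF inner_outer uu power2_eq_square)
    moreover have "B \<bullet> B = n - 1"
      by (simp add: B_def inner_diff_left inner_diff_right inner_commute[of "outer u u" "mat 1"]
          inner_mat1_outer inner_mat1_mat1 inner_outer uu n_def)
    moreover have "A \<bullet> B = N - \<mu>"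
      by (simp add: A_def B_def inner_diff_left inner_diff_right inner_commute[of F "mat 1"]
          inner_commute[of "outer u u" "mat 1"] IF inner_mat1_outer inner_outer uu Fu)
    ultimately show ?thesis
      using Cauchy_Schwarz_ineq[of A B] by (simp add: mult.commute)
  qed

  have bessel: "4 * (s * \<mu> + (1 - s) * (x \<bullet> u)\<^sup>2) - s / D * (4 * \<mu>\<^sup>2 * (x \<bullet> u)\<^sup>2)
      \<le> (1 - s) * (2 + 2 * (x \<bullet> u)\<^sup>2)" if x: "x \<in> X" for x
  proof -
    \<comment> \<open>Pairing the symmetric \<open>W\<close> with \<open>outer y y\<close> produces
      the summand of the eigenvector equation, so the linear sum is known exactly; the constant
      angle settles the sum of squares.\<close>
    define W where "W = outer x u + outer u x"
    have W: "W \<bullet> outer y y = 2 * ((y \<bullet> u) * (y \<bullet> x))" for y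
      by (simp add: W_def inner_add_left inner_outer inner_commute[of _ y])
    have "(\<Sum>y\<in>X. (W \<bullet> outer y y)\<^sup>2) = 4 * (\<Sum>y\<in>X. (x \<bullet> y)\<^sup>2 * (y \<bullet> u)\<^sup>2)"
      by (simp add: W sum_distrib_left power_mult_distrib inner_commute mult_ac)
    also have "(\<Sum>y\<in>X. (x \<bullet> y)\<^sup>2 * (y \<bullet> u)\<^sup>2) = (x \<bullet> u)\<^sup>2 + s * \<mu> - s * (x \<bullet> u)\<^sup>2"
      using sum_equal_off_diagonal[OF fin x, of "\<lambda>y. (x \<bullet> y)\<^sup>2 * (y \<bullet> u)\<^sup>2" "(x \<bullet> u)\<^sup>2"
          "\<lambda>y. s * (y \<bullet> u)\<^sup>2"] unit off x by (simp add: sum_distrib_left[symmetric] q)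
    finally have "(\<Sum>y\<in>X. (W \<bullet> outer y y)\<^sup>2) = 4 * (s * \<mu> + (1 - s) * (x \<bullet> u)\<^sup>2)"
      by (simp add: algebra_simps)
    moreover have "(\<Sum>y\<in>X. W \<bullet> outer y y) = 2 * (\<mu> * (x \<bullet> u))"
      unfolding W sum_distrib_left[symmetric] eig by (simp add: inner_commute)
    moreover have "W \<bullet> W = 2 + 2 * (x \<bullet> u)\<^sup>2"
      using unit[OF x] by (simp add: W_def inner_add_left inner_add_right inner_outer uu
          inner_commute power2_eq_square)
    moreover have "(\<Sum>y\<in>X. (W \<bullet> outer y y)\<^sup>2) - s / D * (\<Sum>y\<in>X. W \<bullet> outer y y)\<^sup>2
        \<le> (1 - s) * (W \<bullet> W)"
      unfolding D_def N_def using s unit off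
      by (intro bessel_constant_inner[OF fin]) (auto simp: inner_outer power2_eq_square)
    ultimately show ?thesis by (simp add: power_mult_distrib)
  qed
  have "(\<Sum>x\<in>X. 4 * (s * \<mu> + (1 - s) * (x \<bullet> u)\<^sup>2) - s / D * (4 * \<mu>\<^sup>2 * (x \<bullet> u)\<^sup>2))
      \<le> (\<Sum>x\<in>X. (1 - s) * (2 + 2 * (x \<bullet> u)\<^sup>2))"
    by (intro sum_mono bessel)
  then have "4 * (N * (s * \<mu>) + (1 - s) * \<mu>) - s / D * (4 * \<mu>\<^sup>2 * \<mu>) \<le> (1 - s) * (2 * N + 2 * \<mu>)"
    by (simp add: sum_subtractf sum.distrib sum_distrib_left[symmetric]
        sum_divide_distrib[symmetric] q N_def algebra_simps)
  moreover have "4 * (N * (s * \<mu>) + (1 - s) * \<mu>) - s / D * (4 * \<mu>\<^sup>2 * \<mu>)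
      = 2 * (2 * D * \<mu> - 2 * (s / D * \<mu>^3))"
  proof -
    have "N * (s * \<mu>) + (1 - s) * \<mu> = D * \<mu>"
      by (simp add: D_def algebra_simps)
    then show ?thesis by (simp add: power2_eq_square power3_eq_cube)
  qed
  moreover have "(1 - s) * (2 * N + 2 * \<mu>) = 2 * ((1 - s) * (N + \<mu>))"
    by (simp add: algebra_simps)
  ultimately have "2 * D * \<mu> - 2 * (s / D * \<mu>^3) \<le> (1 - s) * (N + \<mu>)"
    by (simp only: mult_le_cancel_left_pos[OF zero_less_numeral])
  then have "D * (2 * D * \<mu> - 2 * (s / D * \<mu>^3)) \<le> D * ((1 - s) * (N + \<mu>))"
    using D by (intro mult_left_mono) auto
  moreover have "D * (2 * D * \<mu> - 2 * (s / D * \<mu>^3)) = 2 * D\<^sup>2 * \<mu> - 2 * s * \<mu>^3"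
    using D by (simp add: right_diff_distrib power2_eq_square)
  ultimately have cubic: "2 * D\<^sup>2 * \<mu> - 2 * s * \<mu>^3 \<le> D * (1 - s) * (N + \<mu>)"
    by simp
  \<comment> \<open>Since s N = D - (1 - s), subtracting 2 D (1 - s) \<mu> from \<open>cubic\<close>
    exposes N D - \<mu>^2 on the left and turns N + \<mu> into N - \<mu>, which later cancels
    against \<open>trace\<close>.\<close>
  have "2 * s * \<mu> * (N * D - \<mu>\<^sup>2) = (2 * D\<^sup>2 * \<mu> - 2 * s * \<mu>^3) - 2 * D * (1 - s) * \<mu>"
    by (simp add: D_def power2_eq_square power3_eq_cube algebra_simps)
  also have "\<dots> \<le> D * (1 - s) * (N - \<mu>)"
    using cubic by (simp add: algebra_simps)
  finally have deficit: "2 * s * \<mu> * (N * D - \<mu>\<^sup>2) \<le> D * (1 - s) * (N - \<mu>)" .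

  have "2 * s * \<mu> * (N - \<mu>)\<^sup>2 \<le> 2 * s * \<mu> * ((n - 1) * (N * D - \<mu>\<^sup>2))"
    using trace s \<mu> by (intro mult_left_mono) auto
  also have "\<dots> \<le> (n - 1) * (D * (1 - s) * (N - \<mu>))"
    using mult_left_mono[OF deficit, of "n - 1"] n by (simp add: mult_ac)
  finally have "(2 * s * (\<mu> * (N - \<mu>))) * (N - \<mu>) \<le> ((n - 1) * (D * (1 - s))) * (N - \<mu>)"
    by (simp add: power2_eq_square mult_ac)
  then have main: "2 * s * (\<mu> * (N - \<mu>)) \<le> (n - 1) * (D * (1 - s))"
    using \<mu>N N by (simp add: mult_le_cancel_right)
  \<comment> \<open>The map t (N - t) increases up to N/2, so D \<le> \<mu> \<le> N/2 allows
    replacing \<mu> by \<open>D\<close>.\<close>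
  have "0 \<le> (\<mu> - D) * (N - \<mu> - D)"
    using \<mu>D \<mu>N by (intro mult_nonneg_nonneg) auto
  then have "D * (N - D) \<le> \<mu> * (N - \<mu>)" by (simp add: algebra_simps)
  then have "2 * s * (D * (N - D)) \<le> 2 * s * (\<mu> * (N - \<mu>))"
    using s by (intro mult_left_mono) auto
  with main have "2 * s * (D * (N - D)) \<le> (n - 1) * (D * (1 - s))" by simp
  moreover have "N - D = (N - 1) * (1 - s)" by (simp add: D_def algebra_simps)
  ultimately have "(2 * s * (N - 1)) * (D * (1 - s)) \<le> (n - 1) * (D * (1 - s))"
    by (simp add: mult_ac)
  then have "2 * s * (N - 1) \<le> n - 1"
    using D s by (simp add: mult_le_cancel_right)
  then show ?thesis by (simp add: s_def N_def n_def)
qed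

theorem theorem3:
  fixes a :: real
  assumes "a \<ge> 3"
  shows "real (max_equiangular TYPE('n::finite) (1 / a))
           \<le> real CARD('n) * (2 / 3 * a\<^sup>2 + 4 / 7) + 2"
proof -
  have a2: "9 \<le> a\<^sup>2" using power_mono[OF assms, of 2] by simp
  have n: "real CARD('n) \<ge> 1" by (simp add: Suc_le_eq)
  have "max_equiangular TYPE('n) (1 / a) \<in> {card X | X :: (real ^ 'n) set. equiangular_set (1 / a) X}"
    unfolding max_equiangular_def using assms
    by (intro Max_in finite_equiangular_cards equiangular_cards_nonempty) auto
  then obtain X :: "(real ^ 'n) set" where X: "equiangular_set (1 / a) X"
    and M: "max_equiangular TYPE('n) (1 / a) = card X" by auto
  have "real (card X) \<le> real CARD('n) * (2 / 3 * a\<^sup>2 + 4 / 7) + 2"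
  proof (cases "card X \<ge> 7")
    case True
    have "(1 / a)\<^sup>2 \<le> 1 / 9" using a2 by (simp add: power_one_over divide_le_eq)
    then have "2 * (1 / a)\<^sup>2 * (real (card X) - 1) \<le> real CARD('n) - 1"
      using X True assms by (intro equiangular_card_bound) auto
    then have "2 * (1 / a)\<^sup>2 * (real (card X) - 1) * (a\<^sup>2 / 2) \<le> (real CARD('n) - 1) * (a\<^sup>2 / 2)"
      by (intro mult_right_mono) auto
    then have "real (card X) - 1 \<le> (real CARD('n) - 1) * (a\<^sup>2 / 2)"
      using assms by (simp add: power_one_over)
    \<comment> \<open>The slack is a^2/2 against 2 a^2/3.\<close>
    also have "\<dots> \<le> real CARD('n) * (2 / 3 * a\<^sup>2 + 4 / 7)"
      using n a2 by (intro mult_mono) auto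
    finally show ?thesis by simp
  next
    case False
    \<comment> \<open>For at most 6 points the worst case, dimension 1 and a = 3, already gives 6 +
      4/7.\<close>
    have "1 * (2 / 3 * 9 + 4 / 7) \<le> real CARD('n) * (2 / 3 * a\<^sup>2 + 4 / 7)"
      using n a2 by (intro mult_mono) auto
    moreover have "real (card X) \<le> 2 / 3 * 9 + 4 / 7" using False by simp
    ultimately show ?thesis unfolding mult_1 by (meson add_increasing2 order_trans zero_le_numeral)
  qed
  then show ?thesis by (simp add: M)
qed

end
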